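(* Let $\Gamma$ be a countable (undirected) graph. Then there exist $2^{\aleph_0}$ pairwise non-isomorphic countable algebraically closed directed graphs whose automorphism group is isomorphic to $\operatorname{Aut}\Gamma$.
   Context: A graph is a pair $(V,E)$ with $E$ an irreflexive symmetric binary relation on the non-empty set $V$. A directed graph is a pair $(V,E)$ with $E$ an irreflexive binary relation on the non-empty set $V$. A directed graph $(V,E)$ is algebraically closed if for every finite set $A\subseteq V$ there is a vertex $v$ with $(u,v)\in E$ and $(v,u)\in E$ for all $u\in A$. *)

theory Defs
  imports "HOL-Algebra.Bij" "HOL-Library.Countable_Set" "HOL-Library.Equipollence"
begin

type_synonym 'v digraph = "'v set \<times> ('v \<times> 'v) set"

abbreviation verts :: "'v digraph \<Rightarrow> 'v set" where
  "verts G \<equiv> fst G"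

abbreviation edges :: "'v digraph \<Rightarrow> ('v \<times> 'v) set" where
  "edges G \<equiv> snd G"

definition is_digraph :: "'v digraph \<Rightarrow> bool" where
  "is_digraph G \<longleftrightarrow> verts G \<noteq> {} \<and> edges G \<subseteq> verts G \<times> verts G \<and> irrefl (edges G)"

definition is_graph :: "'v digraph \<Rightarrow> bool" where
  "is_graph G \<longleftrightarrow> verts G \<noteq> {} \<and> edges G \<subseteq> verts G \<times> verts G \<and> irrefl (edges G) \<and> sym (edges G)"

definition alg_closed :: "'v digraph \<Rightarrow> bool" where
  "alg_closed G \<longleftrightarrow>
     (\<forall>A. A \<subseteq> verts G \<and> finite A \<longrightarrow>
        (\<exists>v\<in>verts G. \<forall>u\<in>A. (u, v) \<in> edges G \<and> (v, u) \<in> edges G))"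

definition digraph_iso :: "('v \<Rightarrow> 'w) \<Rightarrow> 'v digraph \<Rightarrow> 'w digraph \<Rightarrow> bool" where
  "digraph_iso f G H \<longleftrightarrow>
     bij_betw f (verts G) (verts H) \<and>
     (\<forall>u\<in>verts G. \<forall>v\<in>verts G. (u, v) \<in> edges G \<longleftrightarrow> (f u, f v) \<in> edges H)"

definition digraph_isomorphic :: "'v digraph \<Rightarrow> 'w digraph \<Rightarrow> bool" where
  "digraph_isomorphic G H \<longleftrightarrow> (\<exists>f. digraph_iso f G H)"

text \<open>Elements of \<^const>\<open>Bij\<close> are extensional, so each automorphism is represented by exactly
  one HOL function; the group operation is composition, inherited from \<^const>\<open>BijGroup\<close>.\<close>

definition Aut :: "'v digraph \<Rightarrow> ('v \<Rightarrow> 'v) monoid" where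
  "Aut G = BijGroup (verts G) \<lparr>carrier := {f \<in> Bij (verts G). digraph_iso f G G}\<rparr>"

end

theory Submission
  imports Defs
begin

text \<open>Passing to the complement preserves isomorphisms and turns algebraic closedness into the
  condition that every finite set of vertices misses all neighbours of some further vertex. So it
  suffices to take the complement of the disjoint union of \<open>\<Gamma>\<close> and a rigid, infinite, locally finite
  directed graph on the naturals that encodes a set \<open>S\<close>. The edges of the latter are all one-way and
  those of \<open>\<Gamma>\<close> are all two-way, so isomorphisms cannot mix the two parts.\<close>

section \<open>Rigid directed graphs on the naturals\<close>

definition ray :: "nat set \<Rightarrow> (nat \<times> nat) set" where
  "ray S = {(i, j). j = Suc i \<or> (j = Suc (Suc i) \<and> i \<in> S)}"

lemma ray_less: "(i, j) \<in> ray S \<Longrightarrow> i < j"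
  by (auto simp: ray_def)

text \<open>Every edge increases, and every vertex has an edge to its successor. Once all numbers
  below \<open>n\<close> are fixed, the preimage of \<open>n\<close> cannot lie above
  \<open>n\<close>: its predecessor would have to be sent below \<open>n\<close>, where every value
  is already taken. Allowing \<open>S\<close> and \<open>T\<close> to differ yields rigidity and the
  recovery of \<open>S\<close> at once.\<close>

lemma ray_iso_is_identity:
  assumes "bij \<phi>" and iso: "\<And>i j. (i, j) \<in> ray S \<longleftrightarrow> (\<phi> i, \<phi> j) \<in> ray T"
  shows "\<phi> n = n"
proof (induction n rule: less_induct)
  case (less n)
  have inj: "\<phi> a = \<phi> b \<Longrightarrow> a = b" for a b
    using \<open>bij \<phi>\<close> by (meson bij_is_inj injD)
  obtain m where m: "\<phi> m = n"
    using \<open>bij \<phi>\<close> by (metis bij_pointE)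
  have "\<not> m < n"
    using less m inj by (metis less_irrefl)
  moreover have "\<not> n < m"
  proof
    assume "n < m"
    then obtain k where k: "m = Suc k" "n \<le> k"
      by (cases m) auto
    then have "(\<phi> k, n) \<in> ray T"
      using iso[of k m] m by (simp add: ray_def)
    then have "\<phi> k < n"
      by (rule ray_less)
    then show False
      using less inj k by (metis not_less)
  qed
  ultimately show ?case
    using m by simp
qed

text \<open>The chords of length two record exactly the elements of \<open>S\<close>.\<close>

lemma ray_inject: "ray S = ray T \<longleftrightarrow> S = T"
proof -
  have "i \<in> S \<longleftrightarrow> (i, Suc (Suc i)) \<in> ray S" for i S
    by (auto simp: ray_def)
  then show ?thesis
    by blast
qed

lemma carrier_mult_Aut:
  "f \<in> carrier (Aut G) \<longleftrightarrow> f \<in> Bij (verts G) \<and> digraph_iso f G G"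
  "f \<in> carrier (Aut G) \<Longrightarrow> g \<in> carrier (Aut G) \<Longrightarrow> f \<otimes>\<^bsub>Aut G\<^esub> g = compose (verts G) f g"
  by (auto simp: Aut_def BijGroup_def)

section \<open>The complement of the disjoint union\<close>

locale countable_graph =
  fixes \<Gamma> :: "'a digraph"
  assumes graph: "is_graph \<Gamma>" and countable_verts: "countable (verts \<Gamma>)"
begin

text \<open>Even numbers carry \<open>\<Gamma>\<close> and odd numbers the ray, so the union lives
  on \<open>nat\<close> whatever the vertex type of \<open>\<Gamma>\<close>, and both finite and
  infinite \<open>\<Gamma>\<close> are covered.\<close>

definition in_graph :: "'a \<Rightarrow> nat" where
  "in_graph x = 2 * to_nat_on (verts \<Gamma>) x"

definition in_ray :: "nat \<Rightarrow> nat" where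
  "in_ray n = 2 * n + 1"

definition sum_verts :: "nat set" where
  "sum_verts = in_graph ` verts \<Gamma> \<union> range in_ray"

definition sum_edges :: "nat set \<Rightarrow> (nat \<times> nat) set" where
  "sum_edges S = map_prod in_graph in_graph ` edges \<Gamma> \<union> map_prod in_ray in_ray ` ray S"

definition cosum :: "nat set \<Rightarrow> nat digraph" where
  "cosum S = (sum_verts, {(u, v). u \<in> sum_verts \<and> v \<in> sum_verts \<and> u \<noteq> v \<and> (u, v) \<notin> sum_edges S})"

lemma in_graph_eq_iff [simp]:
  "x \<in> verts \<Gamma> \<Longrightarrow> y \<in> verts \<Gamma> \<Longrightarrow> in_graph x = in_graph y \<longleftrightarrow> x = y"
  using countable_verts by (simp add: in_graph_def)

lemma in_ray_eq_iff [simp]: "in_ray i = in_ray j \<longleftrightarrow> i = j"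
  by (simp add: in_ray_def)

lemma in_graph_neq_in_ray [simp]: "in_graph x \<noteq> in_ray i" "in_ray i \<noteq> in_graph x"
  unfolding in_graph_def in_ray_def by presburger+

lemma edges_verts: "(x, y) \<in> edges \<Gamma> \<Longrightarrow> x \<in> verts \<Gamma> \<and> y \<in> verts \<Gamma>"
  and edges_sym: "(x, y) \<in> edges \<Gamma> \<Longrightarrow> (y, x) \<in> edges \<Gamma>"
  and edges_irrefl: "(x, x) \<notin> edges \<Gamma>"
  using graph by (auto simp: is_graph_def irrefl_def dest: symD)

lemma sum_verts_intros [simp]: "x \<in> verts \<Gamma> \<Longrightarrow> in_graph x \<in> sum_verts" "in_ray i \<in> sum_verts"
  by (auto simp: sum_verts_def)

lemma sum_verts_cases:
  assumes "w \<in> sum_verts"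
  obtains x where "x \<in> verts \<Gamma>" "w = in_graph x" | i where "w = in_ray i"
  using assms by (auto simp: sum_verts_def)

lemma sum_edges_graph [simp]:
  assumes "x \<in> verts \<Gamma>" "y \<in> verts \<Gamma>"
  shows "(in_graph x, in_graph y) \<in> sum_edges S \<longleftrightarrow> (x, y) \<in> edges \<Gamma>"
proof
  assume "(in_graph x, in_graph y) \<in> sum_edges S"
  then obtain a b where "(a, b) \<in> edges \<Gamma>" "in_graph x = in_graph a" "in_graph y = in_graph b"
    by (auto simp: sum_edges_def)
  then show "(x, y) \<in> edges \<Gamma>"
    using assms edges_verts[of a b] by simp
qed (force simp: sum_edges_def)

lemma sum_edges_ray [simp]: "(in_ray i, in_ray j) \<in> sum_edges S \<longleftrightarrow> (i, j) \<in> ray S"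
  by (force simp: sum_edges_def)

lemma sum_edges_mixed [simp]:
  "(in_graph x, in_ray i) \<notin> sum_edges S" "(in_ray i, in_graph x) \<notin> sum_edges S"
  by (auto simp: sum_edges_def)

lemma sum_edges_irrefl: "w \<in> sum_verts \<Longrightarrow> (w, w) \<notin> sum_edges S"
  by (erule sum_verts_cases) (auto simp: edges_irrefl dest: ray_less)

lemma verts_cosum [simp]: "verts (cosum S) = sum_verts"
  by (simp add: cosum_def)

lemma edges_cosum:
  "(u, v) \<in> edges (cosum S) \<longleftrightarrow>
     u \<in> sum_verts \<and> v \<in> sum_verts \<and> u \<noteq> v \<and> (u, v) \<notin> sum_edges S"
  by (simp add: cosum_def)

lemma is_digraph_cosum: "is_digraph (cosum S)"
  \<comment> \<open>\<open>in_ray 0\<close> shows that there is a vertex; as a simp rule,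
    \<open>sum_verts_intros\<close> would rewrite this fact to \<open>True\<close>.\<close>
  using sum_verts_intros(2)[of 0] by (auto simp: is_digraph_def irrefl_def edges_cosum simp del: sum_verts_intros)

lemma alg_closed_cosum: "alg_closed (cosum S)"
  unfolding alg_closed_def
proof (intro allI impI)
  fix A assume A: "A \<subseteq> verts (cosum S) \<and> finite A"
  then obtain n where n: "\<And>a. a \<in> A \<Longrightarrow> a < n"
    by (auto simp: finite_nat_set_iff_bounded)
  \<comment> \<open>A ray vertex in \<open>A\<close> has index \<open>i < n\<close>, and its edges
    reach at most \<open>i + 2 < n + 3\<close>. Edges never go back down, and none join the ray to
    \<open>\<Gamma>\<close>, so \<open>?v\<close> is not adjacent to any member of \<open>A\<close>
    in the union.\<close>
  let ?v = "in_ray (n + 3)"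
  have "(u, ?v) \<in> edges (cosum S) \<and> (?v, u) \<in> edges (cosum S)" if "u \<in> A" for u
  proof -
    have "u \<in> sum_verts"
      using A that by auto
    then show ?thesis
    proof (cases rule: sum_verts_cases)
      case (2 i)
      then have "i < n"
        using n[OF that] by (simp add: in_ray_def)
      then show ?thesis
        using 2 by (auto simp: edges_cosum ray_def)
    qed (simp add: edges_cosum)
  qed
  then show "\<exists>v\<in>verts (cosum S). \<forall>u\<in>A. (u, v) \<in> edges (cosum S) \<and> (v, u) \<in> edges (cosum S)"
    by (intro bexI[of _ ?v]) auto
qed

section \<open>Isomorphisms between the complements\<close>

lemma cosum_iso_iff:
  "digraph_iso f (cosum S) (cosum T) \<longleftrightarrow>
     bij_betw f sum_verts sum_verts \<and>
     (\<forall>u\<in>sum_verts. \<forall>v\<in>sum_verts. (u, v) \<in> sum_edges S \<longleftrightarrow> (f u, f v) \<in> sum_edges T)"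
proof (cases "bij_betw f sum_verts sum_verts")
  case True
  have "((u, v) \<in> edges (cosum S) \<longleftrightarrow> (f u, f v) \<in> edges (cosum T)) \<longleftrightarrow>
      ((u, v) \<in> sum_edges S \<longleftrightarrow> (f u, f v) \<in> sum_edges T)"
    if "u \<in> sum_verts" "v \<in> sum_verts" for u v
  proof -
    have fV: "f u \<in> sum_verts" "f v \<in> sum_verts"
      using True that by (auto dest: bij_betwE)
    \<comment> \<open>A bijection preserves distinctness and the union has no loops, so the side
      condition \<open>u \<noteq> v\<close> of the complement carries no further
      information.\<close>
    have "f u = f v \<longleftrightarrow> u = v"
      using True that by (auto simp: bij_betw_def dest: inj_onD)
    then show ?thesis
      using that fV sum_edges_irrefl by (auto simp: edges_cosum)
  qed
  then show ?thesis
    using True by (simp add: digraph_iso_def)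
qed (simp add: digraph_iso_def)

text \<open>Each ray vertex has a one-way edge to its successor, whereas all edges at a vertex of
  \<open>\<Gamma>\<close> are two-way. The right-hand side is invariant under isomorphism.\<close>

lemma ray_part_iff:
  assumes "w \<in> sum_verts"
  shows "w \<in> range in_ray \<longleftrightarrow> (\<exists>v\<in>sum_verts. (w, v) \<in> sum_edges S \<and> (v, w) \<notin> sum_edges S)"
  using assms
proof (cases rule: sum_verts_cases)
  case (1 x)
  then show ?thesis
    by (auto elim!: sum_verts_cases dest: edges_sym)
next
  case (2 i)
  moreover have "(i, Suc i) \<in> ray S" "(Suc i, i) \<notin> ray S"
    by (auto simp: ray_def)
  ultimately show ?thesis
    by (auto intro!: bexI[of _ "in_ray (Suc i)"])
qed

lemma cosum_iso_ray_part:
  assumes "digraph_iso f (cosum S) (cosum T)" "w \<in> sum_verts"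
  shows "f w \<in> range in_ray \<longleftrightarrow> w \<in> range in_ray"
proof -
  have f: "bij_betw f sum_verts sum_verts"
    "\<And>u v. u \<in> sum_verts \<Longrightarrow> v \<in> sum_verts \<Longrightarrow> (u, v) \<in> sum_edges S \<longleftrightarrow> (f u, f v) \<in> sum_edges T"
    using assms(1) by (auto simp: cosum_iso_iff)
  \<comment> \<open>Surjectivity lets the witness range over the image of \<open>sum_verts\<close>,
    so that it can be pulled back along \<open>f\<close>.\<close>
  have "f w \<in> range in_ray \<longleftrightarrow>
      (\<exists>v\<in>f ` sum_verts. (f w, v) \<in> sum_edges T \<and> (v, f w) \<notin> sum_edges T)"
    using ray_part_iff[of "f w" T] assms(2) f(1) bij_betwE[OF f(1)] bij_betw_imp_surj_on[OF f(1)]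
    by simp
  also have "\<dots> \<longleftrightarrow> w \<in> range in_ray"
    using ray_part_iff[of w S] assms(2) f(2) by auto
  finally show ?thesis .
qed

text \<open>The restriction of \<open>f\<close> to the ray part is a bijection \<open>\<phi>\<close>
  of the naturals carrying \<open>ray S\<close> to \<open>ray T\<close>, hence the identity.\<close>

lemma cosum_iso_ray:
  assumes "digraph_iso f (cosum S) (cosum T)"
  shows "f (in_ray i) = in_ray i" and "S = T"
proof -
  have bij: "bij_betw f sum_verts sum_verts"
    and edge: "\<And>u v. u \<in> sum_verts \<Longrightarrow> v \<in> sum_verts \<Longrightarrow>
      (u, v) \<in> sum_edges S \<longleftrightarrow> (f u, f v) \<in> sum_edges T"
    using assms by (auto simp: cosum_iso_iff)
  have "\<forall>i. \<exists>j. f (in_ray i) = in_ray j"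
    using cosum_iso_ray_part[OF assms sum_verts_intros(2)] by blast
  then obtain \<phi> where \<phi>: "\<And>i. f (in_ray i) = in_ray (\<phi> i)"
    by metis
  have "inj \<phi>"
    using bij \<phi> by (metis bij_betw_inv_into_left in_ray_eq_iff injI sum_verts_intros(2))
  moreover have "\<exists>i. j = \<phi> i" for j
  proof -
    obtain w where w: "w \<in> sum_verts" "f w = in_ray j"
      using bij by (metis bij_betw_imp_surj_on imageE sum_verts_intros(2))
    then obtain i where "w = in_ray i"
      using cosum_iso_ray_part[OF assms] by blast
    then show ?thesis
      using w \<phi> by auto
  qed
  ultimately have "bij \<phi>"
    by (simp add: bij_def surj_def)
  moreover have ray: "(i, j) \<in> ray S \<longleftrightarrow> (\<phi> i, \<phi> j) \<in> ray T" for i j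
    using edge[of "in_ray i" "in_ray j"] by (simp add: \<phi>)
  ultimately have id: "\<phi> i = i" for i
    by (rule ray_iso_is_identity)
  then show "f (in_ray i) = in_ray i"
    by (simp add: \<phi>)
  have "ray S = ray T"
    using ray id by auto
  then show "S = T"
    by (simp add: ray_inject)
qed

section \<open>Transfer of automorphisms to and from the graph\<close>

definition on_graph :: "(nat \<Rightarrow> nat) \<Rightarrow> 'a \<Rightarrow> 'a" where
  "on_graph f = (\<lambda>x\<in>verts \<Gamma>. inv_into (verts \<Gamma>) in_graph (f (in_graph x)))"

text \<open>Since \<open>f\<close> sends no vertex of \<open>\<Gamma>\<close> into the ray, the
  \<open>inv_into\<close> in \<open>on_graph\<close> is applied only to values in the image of
  \<open>in_graph\<close>.\<close>

lemma in_graph_on_graph: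
  assumes "digraph_iso f (cosum S) (cosum T)" "x \<in> verts \<Gamma>"
  shows "on_graph f x \<in> verts \<Gamma>" "in_graph (on_graph f x) = f (in_graph x)"
proof -
  have "f (in_graph x) \<in> sum_verts"
    using assms by (auto simp: cosum_iso_iff dest: bij_betwE)
  moreover have "f (in_graph x) \<notin> range in_ray"
    using cosum_iso_ray_part[OF assms(1), of "in_graph x"] assms(2) by auto
  ultimately have "f (in_graph x) \<in> in_graph ` verts \<Gamma>"
    by (auto simp: sum_verts_def)
  then show "on_graph f x \<in> verts \<Gamma>" "in_graph (on_graph f x) = f (in_graph x)"
    using assms(2) by (auto simp: on_graph_def inv_into_into f_inv_into_f)
qed

lemma on_graph_Aut:
  assumes "f \<in> carrier (Aut (cosum S))"
  shows "on_graph f \<in> carrier (Aut \<Gamma>)"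
proof -
  have f: "digraph_iso f (cosum S) (cosum S)"
    using assms by (simp add: carrier_mult_Aut)
  then have bij: "bij_betw f sum_verts sum_verts"
    by (simp add: cosum_iso_iff)
  note g = in_graph_on_graph[OF f]
  have "inj_on (on_graph f) (verts \<Gamma>)"
  proof (rule inj_onI)
    fix x y assume xy: "x \<in> verts \<Gamma>" "y \<in> verts \<Gamma>" "on_graph f x = on_graph f y"
    then have "f (in_graph x) = f (in_graph y)"
      using g(2) by metis
    then show "x = y"
      using bij xy by (auto simp: bij_betw_def dest!: inj_onD)
  qed
  moreover have "on_graph f ` verts \<Gamma> = verts \<Gamma>"
  proof (intro equalityI subsetI)
    fix y assume y: "y \<in> verts \<Gamma>"
    then obtain w where w: "w \<in> sum_verts" "f w = in_graph y"
      using bij by (metis bij_betw_imp_surj_on imageE sum_verts_intros(1))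
    from w(1) show "y \<in> on_graph f ` verts \<Gamma>"
    proof (cases rule: sum_verts_cases)
      case (1 x)
      then show ?thesis
        using g[of x] w y by (metis imageI in_graph_eq_iff)
    next
      \<comment> \<open>Ray vertices are fixed by \<open>f\<close>, so none is sent to
        \<open>in_graph y\<close>.\<close>
      case (2 i)
      then show ?thesis
        using cosum_iso_ray(1)[OF f] w by simp
    qed
  qed (use g in auto)
  ultimately have "bij_betw (on_graph f) (verts \<Gamma>) (verts \<Gamma>)"
    by (simp add: bij_betw_def)
  moreover have "(x, y) \<in> edges \<Gamma> \<longleftrightarrow> (on_graph f x, on_graph f y) \<in> edges \<Gamma>"
    if "x \<in> verts \<Gamma>" "y \<in> verts \<Gamma>" for x y
  proof -
    have "(x, y) \<in> edges \<Gamma> \<longleftrightarrow> (f (in_graph x), f (in_graph y)) \<in> sum_edges S"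
      using f that by (metis cosum_iso_iff sum_edges_graph sum_verts_intros(1))
    then show ?thesis
      using that g by (metis sum_edges_graph)
  qed
  ultimately show ?thesis
    by (simp add: carrier_mult_Aut Bij_def digraph_iso_def on_graph_def)
qed

text \<open>The candidate inverse of \<open>on_graph\<close>; rigidity forces the identity on the
  ray. The restriction to \<open>sum_verts\<close> provides the extensionality that
  \<open>Bij\<close> demands.\<close>

definition extend :: "('a \<Rightarrow> 'a) \<Rightarrow> nat \<Rightarrow> nat" where
  "extend g = (\<lambda>w\<in>sum_verts. if w \<in> range in_ray then w
     else in_graph (g (inv_into (verts \<Gamma>) in_graph w)))"

lemma extend_simps [simp]:
  "extend g (in_ray i) = in_ray i"
  "x \<in> verts \<Gamma> \<Longrightarrow> extend g (in_graph x) = in_graph (g x)"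
proof -
  have "inj_on in_graph (verts \<Gamma>)"
    by (simp add: inj_on_def)
  then show "x \<in> verts \<Gamma> \<Longrightarrow> extend g (in_graph x) = in_graph (g x)"
    by (auto simp: extend_def)
qed (simp add: extend_def)

text \<open>Automorphisms of the two parts glue, because no edge of the union runs between
  them.\<close>

lemma extend_Aut:
  assumes "g \<in> carrier (Aut \<Gamma>)"
  shows "extend g \<in> carrier (Aut (cosum S))"
proof -
  have bij: "bij_betw g (verts \<Gamma>) (verts \<Gamma>)"
    and edge: "\<And>x y. x \<in> verts \<Gamma> \<Longrightarrow> y \<in> verts \<Gamma> \<Longrightarrow> (x, y) \<in> edges \<Gamma> \<longleftrightarrow> (g x, g y) \<in> edges \<Gamma>"
    using assms by (auto simp: carrier_mult_Aut digraph_iso_def)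
  have gV [simp]: "x \<in> verts \<Gamma> \<Longrightarrow> g x \<in> verts \<Gamma>" for x
    using bij by (auto dest: bij_betwE)
  have [simp]: "x \<in> verts \<Gamma> \<Longrightarrow> y \<in> verts \<Gamma> \<Longrightarrow> g x = g y \<longleftrightarrow> x = y" for x y
    using bij by (auto simp: bij_betw_def dest: inj_onD)
  have "inj_on (extend g) sum_verts"
    by (rule inj_onI) (auto elim!: sum_verts_cases)
  moreover have "extend g ` sum_verts = sum_verts"
  proof (intro equalityI subsetI)
    fix w assume "w \<in> sum_verts"
    then show "w \<in> extend g ` sum_verts"
    proof (cases rule: sum_verts_cases)
      case (1 y)
      then obtain x where "x \<in> verts \<Gamma>" "y = g x"
        using bij by (metis bij_betw_imp_surj_on imageE)
      then show ?thesis
        using 1 by (intro image_eqI[of _ _ "in_graph x"]) auto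
    next
      case (2 i)
      then show ?thesis
        by (intro image_eqI[of _ _ "in_ray i"]) auto
    qed
  qed (auto elim!: sum_verts_cases)
  ultimately have "bij_betw (extend g) sum_verts sum_verts"
    by (simp add: bij_betw_def)
  moreover have "(u, v) \<in> sum_edges S \<longleftrightarrow> (extend g u, extend g v) \<in> sum_edges S"
    if "u \<in> sum_verts" "v \<in> sum_verts" for u v
    \<comment> \<open>Used from left to right, \<open>edge\<close> would apply again to its own
      result.\<close>
    using that by (auto elim!: sum_verts_cases simp: edge[symmetric])
  ultimately have "digraph_iso (extend g) (cosum S) (cosum S)"
    by (simp add: cosum_iso_iff)
  then show ?thesis
    by (auto simp: carrier_mult_Aut Bij_def digraph_iso_def extend_def)
qed

text \<open>The isomorphism is \<open>on_graph\<close>: it is injective because the ray is fixed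
  pointwise, and surjective by \<open>extend\<close>.\<close>

lemma Aut_cosum: "Aut (cosum S) \<cong> Aut \<Gamma>"
proof -
  have ext: "on_graph f \<in> extensional (verts \<Gamma>)" for f
    by (simp add: on_graph_def)
  have iso: "digraph_iso f (cosum S) (cosum S)" if "f \<in> carrier (Aut (cosum S))" for f
    using that by (simp add: carrier_mult_Aut)
  note g = in_graph_on_graph[OF iso]
  have "on_graph (f \<otimes>\<^bsub>Aut (cosum S)\<^esub> f') = on_graph f \<otimes>\<^bsub>Aut \<Gamma>\<^esub> on_graph f'"
    if f: "f \<in> carrier (Aut (cosum S))" "f' \<in> carrier (Aut (cosum S))" for f f'
  proof -
    have "on_graph (compose sum_verts f f') = compose (verts \<Gamma>) (on_graph f) (on_graph f')"
    proof (rule extensionalityI[OF ext compose_extensional])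
      fix x assume x: "x \<in> verts \<Gamma>"
      then have "on_graph f' x \<in> verts \<Gamma>" "f' (in_graph x) = in_graph (on_graph f' x)"
        using g[OF f(2)] by auto
      then show "on_graph (compose sum_verts f f') x = compose (verts \<Gamma>) (on_graph f) (on_graph f') x"
        \<comment> \<open>\<open>on_graph f'\<close> stays folded, so that
          \<open>f' (in_graph x)\<close> becomes \<open>in_graph (on_graph f' x)\<close>, the form
          of argument that \<open>on_graph f\<close> expects.\<close>
        using x by (simp add: on_graph_def[of f] on_graph_def[of "compose sum_verts f f'"] compose_eq)
    qed
    then show ?thesis
      using f by (simp add: carrier_mult_Aut(2) on_graph_Aut)
  qed
  then have "on_graph \<in> hom (Aut (cosum S)) (Aut \<Gamma>)"
    by (auto simp: hom_def on_graph_Aut)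
  moreover have "inj_on on_graph (carrier (Aut (cosum S)))"
  proof (rule inj_onI)
    fix f f'
    assume f: "f \<in> carrier (Aut (cosum S))" "f' \<in> carrier (Aut (cosum S))"
      and eq: "on_graph f = on_graph f'"
    have "f \<in> extensional sum_verts" "f' \<in> extensional sum_verts"
      using f by (auto simp: carrier_mult_Aut Bij_def)
    then show "f = f'"
    proof (rule extensionalityI)
      fix w assume "w \<in> sum_verts"
      then show "f w = f' w"
        using g(2)[OF f(1)] g(2)[OF f(2)] eq cosum_iso_ray(1)[OF iso[OF f(1)]]
          cosum_iso_ray(1)[OF iso[OF f(2)]]
        by (cases rule: sum_verts_cases) auto
    qed
  qed
  moreover have "h \<in> on_graph ` carrier (Aut (cosum S))" if h: "h \<in> carrier (Aut \<Gamma>)" for h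
  proof
    show e: "extend h \<in> carrier (Aut (cosum S))"
      by (rule extend_Aut[OF h])
    have "h \<in> extensional (verts \<Gamma>)" and hV: "\<And>x. x \<in> verts \<Gamma> \<Longrightarrow> h x \<in> verts \<Gamma>"
      using h by (auto simp: carrier_mult_Aut Bij_def dest: bij_betwE)
    then show "h = on_graph (extend h)"
    proof (rule_tac extensionalityI[OF _ ext])
      fix x assume x: "x \<in> verts \<Gamma>"
      \<comment> \<open>Both sides have the same image under \<open>in_graph\<close>, which is
        injective on the vertices of \<open>\<Gamma>\<close>.\<close>
      show "h x = on_graph (extend h) x"
        using g[OF e x] x hV by simp
    qed
  qed
  ultimately have "on_graph \<in> iso (Aut (cosum S)) (Aut \<Gamma>)"
    using on_graph_Aut by (auto simp: iso_def bij_betw_def)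
  then show ?thesis
    by (rule is_isoI)
qed

end

section \<open>Continuum many pairwise non-isomorphic digraphs\<close>

theorem theorem4p3:
  fixes \<Gamma> :: "'a digraph"
  assumes "is_graph \<Gamma>" and "countable (verts \<Gamma>)"
  shows "\<exists>\<D> :: nat digraph set.
           \<D> \<approx> (UNIV :: nat set set) \<and>
           (\<forall>D\<in>\<D>. is_digraph D \<and> countable (verts D) \<and> alg_closed D \<and> Aut D \<cong> Aut \<Gamma>) \<and>
           pairwise (\<lambda>D D'. \<not> digraph_isomorphic D D') \<D>"
proof -
  interpret countable_graph \<Gamma>
    using assms by unfold_locales
  have noniso: "S = T" if "digraph_isomorphic (cosum S) (cosum T)" for S T
    using that cosum_iso_ray(2) by (auto simp: digraph_isomorphic_def)
  \<comment> \<open>Equal digraphs are isomorphic via the identity, so \<open>noniso\<close> also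
    makes \<open>cosum\<close> injective, and its range has as many elements as there are sets of
    naturals.\<close>
  have "digraph_iso id (cosum S) (cosum S)" for S
    by (simp add: digraph_iso_def)
  then have "inj cosum"
    using noniso by (metis digraph_isomorphic_def injI)
  then have "range cosum \<approx> (UNIV :: nat set set)"
    by (rule inj_on_image_eqpoll_self)
  moreover have "pairwise (\<lambda>D D'. \<not> digraph_isomorphic D D') (range cosum)"
    using noniso by (auto simp: pairwise_def)
  ultimately show ?thesis
    using is_digraph_cosum alg_closed_cosum Aut_cosum by (intro exI[of _ "range cosum"]) auto
qed

end
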